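(* Let $X$ be a complex normed space, $B$ a finite-dimensional complex normed vector space, and $T:X\to B$ a continuous surjective linear map. Define $$q_T(b):=\inf\{\|x\|_X:Tx=b\}\qquad(b\in B).$$ Then $q_T$ is the quotient norm induced by $T$ (the norm on $B$ corresponding to the quotient norm on $X/\ker T$ under the linear isomorphism $X/\ker T\cong B$ induced by $T$), and for every $b\in B$ $$q_T(b)=\sup_{\varphi\in B^*,\ \varphi\ne0}\frac{|\varphi(b)|}{\|T^*\varphi\|_{X^*}}.$$
   Context: $X^*$ and $B^*$ are the continuous duals and $T^*:B^*\to X^*$, $T^*\varphi=\varphi\circ T$. Suprema of nonnegative quantities are taken in $[0,\infty]$, with $\sup\varnothing=0$. *)

theory Defs
  imports "HOL-Analysis.Analysis"
begin

text \<open>The distribution has no complex normed spaces. A complex normed space is taken to be a real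
  normed space with a complex scalar multiplication that extends the real one and for which the
  norm is absolutely homogeneous; the law for the scalar 1 follows from \<open>scaleR_scaleC\<close>.\<close>

class complex_normed_vector = real_normed_vector +
  fixes scaleC :: "complex \<Rightarrow> 'a \<Rightarrow> 'a" (infixr "*\<^sub>C" 75)
  assumes scaleC_add_right: "c *\<^sub>C (x + y) = c *\<^sub>C x + c *\<^sub>C y"
    and scaleC_add_left: "(c + d) *\<^sub>C x = c *\<^sub>C x + d *\<^sub>C x"
    and scaleC_scaleC: "c *\<^sub>C d *\<^sub>C x = (c * d) *\<^sub>C x"
    and scaleR_scaleC: "r *\<^sub>R x = complex_of_real r *\<^sub>C x"
    and norm_scaleC: "norm (c *\<^sub>C x) = cmod c * norm x"

instantiation complex :: complex_normed_vector
begin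

definition scaleC_complex :: "complex \<Rightarrow> complex \<Rightarrow> complex" where
  "scaleC_complex c z = c * z"

instance
  by standard (simp_all add: scaleC_complex_def algebra_simps norm_mult scaleR_conv_of_real)

end

lemma vector_space_scaleC: "vector_space (scaleC :: complex \<Rightarrow> 'a \<Rightarrow> 'a::complex_normed_vector)"
proof
  show "1 *\<^sub>C x = x" for x :: 'a
    using scaleR_scaleC[of 1 x] by simp
qed (simp_all add: scaleC_add_right scaleC_add_left scaleC_scaleC)

abbreviation clinear :: "('a::complex_normed_vector \<Rightarrow> 'b::complex_normed_vector) \<Rightarrow> bool" where
  "clinear \<equiv> Vector_Spaces.linear scaleC scaleC"

definition finite_dim_complex :: "'a::complex_normed_vector itself \<Rightarrow> bool" where
  "finite_dim_complex _ \<longleftrightarrow>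
     (\<exists>S. finite_dimensional_vector_space (scaleC :: complex \<Rightarrow> 'a \<Rightarrow> 'a) S)"

definition is_complex_norm :: "('a::complex_normed_vector \<Rightarrow> real) \<Rightarrow> bool" where
  "is_complex_norm p \<longleftrightarrow>
     (\<forall>x. p x \<ge> 0) \<and> (\<forall>x. p x = 0 \<longleftrightarrow> x = 0) \<and>
     (\<forall>c x. p (c *\<^sub>C x) = cmod c * p x) \<and> (\<forall>x y. p (x + y) \<le> p x + p y)"

text \<open>The norm of a functional is the library's \<^const>\<open>onorm\<close>.\<close>

definition cdual :: "('a::complex_normed_vector \<Rightarrow> complex) set" where
  "cdual = {\<phi>. clinear \<phi> \<and> continuous_on UNIV \<phi>}"

definition dual_map ::
  "('a::complex_normed_vector \<Rightarrow> 'b::complex_normed_vector) \<Rightarrow> ('b \<Rightarrow> complex) \<Rightarrow> 'a \<Rightarrow> complex" where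
  "dual_map T \<phi> = \<phi> \<circ> T"

definition ker :: "('a::complex_normed_vector \<Rightarrow> 'b::complex_normed_vector) \<Rightarrow> 'a set" where
  "ker T = {x. T x = 0}"

text \<open>The quotient by a subspace \<open>K\<close> consists of the cosets of \<open>K\<close>. In the scalar multiple of
  a coset the summand from \<open>K\<close> matters only for the scalar 0, where the plain image
  of a coset would be \<open>{0}\<close> instead of \<open>K\<close>.\<close>

definition quotient_space :: "'a::complex_normed_vector set \<Rightarrow> 'a set set" where
  "quotient_space K = UNIV // {(x, y). x - y \<in> K}"

definition coset_add :: "'a::complex_normed_vector set \<Rightarrow> 'a set \<Rightarrow> 'a set" where
  "coset_add C D = {x + y | x y. x \<in> C \<and> y \<in> D}"

definition coset_scale ::
  "'a::complex_normed_vector set \<Rightarrow> complex \<Rightarrow> 'a set \<Rightarrow> 'a set" where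
  "coset_scale K c C = {c *\<^sub>C x + k | x k. x \<in> C \<and> k \<in> K}"

definition quotient_norm :: "'a::complex_normed_vector set \<Rightarrow> real" where
  "quotient_norm C = (INF x\<in>C. norm x)"

definition is_linear_iso_on_quotient ::
  "'a::complex_normed_vector set \<Rightarrow> ('a set \<Rightarrow> 'b::complex_normed_vector) \<Rightarrow> bool" where
  "is_linear_iso_on_quotient K F \<longleftrightarrow>
     bij_betw F (quotient_space K) UNIV \<and>
     (\<forall>C\<in>quotient_space K. \<forall>D\<in>quotient_space K. F (coset_add C D) = F C + F D) \<and>
     (\<forall>c. \<forall>C\<in>quotient_space K. F (coset_scale K c C) = c *\<^sub>C F C)"

text \<open>A linear map \<open>T\<close> is constant on each coset \<open>C\<close> of its kernel, so \<open>T ` C\<close> is a singleton.\<close>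

definition induced_map ::
  "('a::complex_normed_vector \<Rightarrow> 'b::complex_normed_vector) \<Rightarrow> 'a set \<Rightarrow> 'b" where
  "induced_map T C = the_elem (T ` C)"

definition q_norm ::
  "('a::complex_normed_vector \<Rightarrow> 'b::complex_normed_vector) \<Rightarrow> 'b \<Rightarrow> real" where
  "q_norm T b = Inf {norm x | x. T x = b}"

end

theory Submission
  imports Defs
begin

text \<open>Every coset of the kernel of a surjective linear map \<open>T\<close> is the fibre of \<open>T\<close> over exactly
  one point of the target, and \<open>q_norm T b\<close> is the quotient norm of the fibre over \<open>b\<close>. Hence
  the statements about the quotient are statements about fibres
  (\<open>quotient_space_ker\<close>, \<open>induced_map_iso\<close>), and \<open>q_norm T\<close> inherits the seminorm laws from the
  norm. It is definite because \<open>T\<close> is bounded: a point with preimages of arbitrarily small norm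
  is 0.

  In the dual formula, each ratio is at most \<open>q_norm T b\<close>, because
  \<open>\<bar>\<phi> b\<bar> = \<bar>\<phi> (T x)\<bar> \<le> \<parallel>T\<^sup>* \<phi>\<parallel> \<parallel>x\<parallel>\<close> for every \<open>x\<close> over \<open>b\<close>
  (\<open>dual_quotient_le_q_norm\<close>). For \<open>b \<noteq> 0\<close> the bound is attained: Hahn-Banach, applied to the norm
  \<open>q_norm T\<close> on the target, gives a functional \<open>\<phi>\<close> with \<open>\<bar>\<phi>\<bar> \<le> q_norm T\<close> and equality at \<open>b\<close>.
  Since \<open>q_norm T (T x) \<le> \<parallel>x\<parallel>\<close>, the pullback of \<open>\<phi>\<close> has norm at most 1
  (\<open>q_norm_attained\<close>).

  Two facts about finite-dimensional spaces carry this. Hahn-Banach is proved without Zorn's lemma: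
  a sublinear functional is lowered finitely many times, each time becoming linear on one more
  line, until it is linear on a spanning set and therefore everywhere
  (\<open>hahn_banach_finite_dim\<close>). The functional so obtained is dominated by \<open>q_norm T\<close>, not by the
  given norm of the target, so its continuity is a separate matter: every linear functional on a
  finite-dimensional normed space is bounded (\<open>bounded_linear_if_finite_dim\<close>), which follows
  from Hahn-Banach for the norm, without a compactness argument.\<close>

section \<open>Sublinear functionals and the Hahn-Banach theorem\<close>

definition sublinear :: "('a::real_vector \<Rightarrow> real) \<Rightarrow> bool" where
  "sublinear p \<longleftrightarrow> (\<forall>x y. p (x + y) \<le> p x + p y) \<and> (\<forall>c\<ge>0. \<forall>x. p (c *\<^sub>R x) = c * p x)"

lemma sublinear_add: "sublinear p \<Longrightarrow> p (x + y) \<le> p x + p y"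
  by (simp add: sublinear_def)

lemma sublinear_scale: "sublinear p \<Longrightarrow> c \<ge> 0 \<Longrightarrow> p (c *\<^sub>R x) = c * p x"
  by (simp add: sublinear_def)

lemma sublinear_zero: "sublinear p \<Longrightarrow> p 0 = 0"
  using sublinear_scale[of p 0 0] by simp

lemma sublinear_uminus_ge: "sublinear p \<Longrightarrow> - p (- x) \<le> p x"
  using sublinear_add[of p x "- x"] sublinear_zero[of p] by simp

lemma sublinear_norm: "sublinear (norm :: 'a::real_normed_vector \<Rightarrow> real)"
  by (simp add: sublinear_def norm_triangle_ineq)

text \<open>The largest sublinear functional below a sublinear \<open>p\<close> with value at most \<open>- p a\<close> at \<open>- a\<close>. It is
  linear on the line through \<open>a\<close> and keeps the value \<open>p a\<close>.\<close>

definition straighten :: "('a::real_vector \<Rightarrow> real) \<Rightarrow> 'a \<Rightarrow> 'a \<Rightarrow> real" where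
  "straighten p a x = (INF t\<in>{0..}. p (x + t *\<^sub>R a) - t * p a)"

lemma straighten_le:
  assumes "sublinear p" "t \<ge> 0"
  shows "straighten p a x \<le> p (x + t *\<^sub>R a) - t * p a"
proof -
  (* s a = (x + s a) + (- x), so p (- x) bounds the infimum from below independently of s. *)
  have "- p (- x) \<le> p (x + s *\<^sub>R a) - s * p a" if "s \<ge> 0" for s
    using sublinear_add[OF assms(1), of "x + s *\<^sub>R a" "- x"]
      sublinear_scale[OF assms(1) that, of a] by simp
  then have "bdd_below ((\<lambda>s. p (x + s *\<^sub>R a) - s * p a) ` {0..})"
    by (intro bdd_belowI2[where m = "- p (- x)"]) auto
  then show ?thesis
    unfolding straighten_def using assms(2) by (intro cINF_lower) auto
qed

lemma straighten_greatest:
  assumes "\<And>t. t \<ge> 0 \<Longrightarrow> m \<le> p (x + t *\<^sub>R a) - t * p a"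
  shows "m \<le> straighten p a x"
  unfolding straighten_def using assms by (intro cINF_greatest) auto

lemma straighten_le_self: "sublinear p \<Longrightarrow> straighten p a x \<le> p x"
  using straighten_le[of p 0 a x] by simp

lemma sublinear_straighten:
  assumes p: "sublinear p"
  shows "sublinear (straighten p a)"
proof -
  have add: "straighten p a (x + y) \<le> straighten p a x + straighten p a y" for x y
  proof -
    have "straighten p a (x + y) \<le>
        (p (x + s *\<^sub>R a) - s * p a) + (p (y + t *\<^sub>R a) - t * p a)"
      if "s \<ge> 0" "t \<ge> 0" for s t
      using straighten_le[OF p, of "s + t" a "x + y"] that
        sublinear_add[OF p, of "x + s *\<^sub>R a" "y + t *\<^sub>R a"]
      by (simp add: algebra_simps)
    then have "straighten p a (x + y) - (p (x + s *\<^sub>R a) - s * p a) \<le> straighten p a y"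
      if "s \<ge> 0" for s
      using that by (intro straighten_greatest) (simp add: diff_le_eq add.commute)
    then have "straighten p a (x + y) - straighten p a y \<le> straighten p a x"
      by (intro straighten_greatest) (simp add: diff_le_eq add.commute)
    then show ?thesis by simp
  qed
  have scale_le: "c * straighten p a x \<le> straighten p a (c *\<^sub>R x)" if "c > 0" for c x
  proof (rule straighten_greatest)
    fix t :: real assume "t \<ge> 0"
    then have "c * straighten p a x \<le> c * (p (x + (t / c) *\<^sub>R a) - (t / c) * p a)"
      using straighten_le[OF p, of "t / c" a x] that by (intro mult_left_mono) auto
    also have "\<dots> = p (c *\<^sub>R x + t *\<^sub>R a) - t * p a"
      using sublinear_scale[OF p, of c "x + (t / c) *\<^sub>R a"] that
      by (simp add: right_diff_distrib scaleR_add_right)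
    finally show "c * straighten p a x \<le> p (c *\<^sub>R x + t *\<^sub>R a) - t * p a" .
  qed
  have zero: "straighten p a 0 = 0"
    using sublinear_scale[OF p] by (simp add: straighten_def)
  have "straighten p a (c *\<^sub>R x) = c * straighten p a x" if "c \<ge> 0" for c x
  proof (cases "c = 0")
    case True
    then show ?thesis using zero by simp
  next
    case False
    then have "c > 0" using that by simp
    then have "inverse c * straighten p a (c *\<^sub>R x) \<le> straighten p a x"
      using scale_le[of "inverse c" "c *\<^sub>R x"] by simp
    then have "straighten p a (c *\<^sub>R x) \<le> c * straighten p a x"
      using \<open>c > 0\<close> by (simp add: field_simps)
    then show ?thesis using scale_le[OF \<open>c > 0\<close>] by (simp add: antisym)
  qed
  with add show ?thesis by (simp add: sublinear_def)
qed

text \<open>Straightness on a line survives further lowering: below \<open>p\<close> at both \<open>a\<close> and \<open>- a\<close>, where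
  the values of \<open>p\<close> cancel, subadditivity leaves a sublinear functional no room. This is what allows
  directions to be straightened one after the other.\<close>

lemma sublinear_below_straight:
  assumes q: "sublinear q" and le: "\<And>x. q x \<le> p x" and straight: "p (- a) = - p a"
  shows "q a = p a" "q (- a) = - q a"
  using le[of a] le[of "- a"] straight sublinear_uminus_ge[OF q, of a] by simp_all

lemma straighten_straight:
  assumes p: "sublinear p"
  shows "straighten p a a = p a" "straighten p a (- a) = - straighten p a a"
proof -
  (* Take t = 1 in the infimum. *)
  have "straighten p a (- a) \<le> - p a"
    using straighten_le[OF p, of 1 a "- a"] sublinear_zero[OF p] by simp
  then show "straighten p a a = p a" "straighten p a (- a) = - straighten p a a"
    using straighten_le_self[OF p, of a a]
      sublinear_uminus_ge[OF sublinear_straighten[OF p], of a a] by simp_all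
qed

lemma exists_straight_on_finite:
  assumes "finite F" "sublinear p"
  shows "\<exists>q. sublinear q \<and> (\<forall>x. q x \<le> p x) \<and> (\<forall>a\<in>F. q (- a) = - q a)"
  using assms
proof (induction F arbitrary: p rule: finite_induct)
  case empty
  then show ?case by auto
next
  case (insert a F)
  obtain q where q: "sublinear q" "\<And>x. q x \<le> straighten p a x" "\<forall>a\<in>F. q (- a) = - q a"
    using insert.IH[OF sublinear_straighten[OF insert.prems]] by blast
  have "q (- a) = - q a"
    by (rule sublinear_below_straight(2)[of q "straighten p a" a,
          OF q(1,2) straighten_straight(2)[of p a, OF insert.prems]])
  moreover have "q x \<le> p x" for x
    using q(2)[of x] straighten_le_self[OF insert.prems, of a x] by simp
  ultimately show ?case using q by blast
qed

text \<open>If \<open>p\<close> is odd at \<open>x\<close> and at \<open>y\<close>, subadditivity at \<open>x + y\<close> and at \<open>- (x + y)\<close> bounds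
  \<open>p (x + y)\<close> by \<open>p x + p y\<close> from both sides. So the vectors where \<open>p\<close> is odd form a subspace on which
  \<open>p\<close> is additive.\<close>

lemma linear_if_straight_on_spanning:
  assumes p: "sublinear p" and F: "span F = UNIV" and straight: "\<forall>a\<in>F. p (- a) = - p a"
  shows "linear p"
proof -
  have add_straight: "p (x + y) = p x + p y \<and> p (- (x + y)) = - p (x + y)"
    if "p (- x) = - p x" "p (- y) = - p y" for x y
    using that sublinear_add[OF p, of x y] sublinear_add[OF p, of "- x" "- y"]
      sublinear_uminus_ge[OF p, of "x + y"] by simp
  have scale_straight: "p (c *\<^sub>R x) = c * p x" if "p (- x) = - p x" for c x
  proof (cases "c \<ge> 0")
    case True
    then show ?thesis by (rule sublinear_scale[OF p])
  next
    case False
    then have "p ((- c) *\<^sub>R (- x)) = - c * p (- x)" by (intro sublinear_scale[OF p]) simp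
    then show ?thesis using that by simp
  qed
  have "subspace {x. p (- x) = - p x}"
  proof (rule subspaceI)
    fix c :: real and x assume "x \<in> {x. p (- x) = - p x}"
    then show "c *\<^sub>R x \<in> {x. p (- x) = - p x}"
      using scale_straight[of x c] scale_straight[of x "- c"] by simp
  qed (use add_straight sublinear_zero[OF p] in auto)
  then have "span F \<subseteq> {x. p (- x) = - p x}"
    using straight by (intro span_minimal) auto
  then have "p (- x) = - p x" for x using F by auto
  then show ?thesis using add_straight scale_straight by (intro linearI) auto
qed

text \<open>The vector \<open>a\<close> is straightened first, while the functional still has the value \<open>p a\<close> there;
  the later steps for the spanning set can no longer change this value.\<close>

theorem hahn_banach_finite_dim:
  fixes p :: "'a::real_vector \<Rightarrow> real" and F :: "'a set"
  assumes F: "finite F" "span F = UNIV" and p: "sublinear p"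
  shows "\<exists>u. linear u \<and> (\<forall>x. u x \<le> p x) \<and> u a = p a"
proof -
  obtain u where u: "sublinear u" "\<And>x. u x \<le> straighten p a x" "\<forall>a\<in>F. u (- a) = - u a"
    using exists_straight_on_finite[OF F(1) sublinear_straighten[OF p]] by blast
  have "linear u" by (rule linear_if_straight_on_spanning[OF u(1) F(2) u(3)])
  moreover have "u x \<le> p x" for x
    using u(2)[of x] straighten_le_self[OF p, of a x] by simp
  moreover have "u a = p a"
    using sublinear_below_straight(1)[of u "straighten p a" a,
        OF u(1,2) straighten_straight(2)[of p a, OF p]]
      straighten_straight(1)[OF p, of a] by simp
  ultimately show ?thesis by blast
qed

section \<open>Automatic continuity\<close>

lemma bounded_linear_if_continuous:
  fixes f :: "'a::real_normed_vector \<Rightarrow> 'b::real_normed_vector"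
  assumes lin: "linear f" and cont: "continuous_on UNIV f"
  shows "bounded_linear f"
proof -
  interpret linear f by (rule lin)
  have "isCont f 0" using cont by (simp add: continuous_on_eq_continuous_at)
  then obtain d where d: "d > 0" "\<And>x. norm x < d \<Longrightarrow> norm (f x) < 1"
    unfolding continuous_at_eps_delta by (auto simp: dist_norm zero)
      (metis zero_less_one)
  have "norm (f x) \<le> norm x * (2 / d)" for x
  proof (cases "x = 0")
    case True
    then show ?thesis by (simp add: zero)
  next
    case False
    have "norm (f ((d / (2 * norm x)) *\<^sub>R x)) < 1"
      using d(1) False by (intro d(2)) simp
    then show ?thesis using False d(1) by (simp add: scale field_simps)
  qed
  then show ?thesis using lin by (intro bounded_linear.intro bounded_linear_axioms.intro) blast+
qed

text \<open>Coordinates with respect to a growing independent set, without mention of a basis: think of \<open>P\<close>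
  as a projection onto the span of \<open>F\<close> with bounded coordinates. A new vector \<open>v\<close> contributes
  its remainder \<open>w = v - P v\<close>. Hahn-Banach for the norm gives a bounded functional with value
  \<open>\<parallel>w\<parallel>\<close> at \<open>w\<close>; composed with \<open>x - P x\<close> and rescaled it becomes a bounded \<open>k\<close> that vanishes on
  \<open>F\<close> and is 1 at \<open>v\<close>, and \<open>P\<close> is corrected by \<open>k x *\<^sub>R w\<close>. Boundedness is claimed for the composites
  with all functionals rather than for \<open>P\<close>, because then \<open>k\<close> and every corrected composite are
  visibly bounded, and at the end, where \<open>P\<close> is the identity, the claim is about the functionals
  themselves.\<close>

lemma exists_linear_fixing_finite_set:
  fixes S F :: "'a::real_normed_vector set"
  assumes S: "finite S" "span S = UNIV" and "finite F"
  shows "\<exists>P. linear P \<and> (\<forall>x\<in>F. P x = x) \<and>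
           (\<forall>g::'a \<Rightarrow> real. linear g \<longrightarrow> bounded_linear (\<lambda>x. g (P x)))"
  using \<open>finite F\<close>
proof (induction F rule: finite_induct)
  case empty
  have "linear (\<lambda>x::'a. 0::'a)" by (simp add: linear_iff)
  then show ?case by (intro exI[of _ "\<lambda>x. 0"]) (auto simp: linear_0)
next
  case (insert v F)
  then obtain P :: "'a \<Rightarrow> 'a" where P: "linear P" "\<forall>x\<in>F. P x = x"
    and bdd: "\<And>g::'a \<Rightarrow> real. linear g \<Longrightarrow> bounded_linear (\<lambda>x. g (P x))" by blast
  define w where "w = v - P v"
  show ?case
  proof (cases "w = 0")
    case True
    then show ?thesis using P bdd by (intro exI[of _ P]) (auto simp: w_def)
  next
    case False
    obtain u where u: "linear u" "\<And>x. u x \<le> norm x" "u w = norm w"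
      using hahn_banach_finite_dim[OF S sublinear_norm, of w] by blast
    have "\<bar>u x\<bar> \<le> norm x" for x
      using u(2)[of x] u(2)[of "- x"] by (simp add: linear_neg[OF u(1)] abs_le_iff)
    then have bu: "bounded_linear u"
      by (intro bounded_linear.intro u(1) bounded_linear_axioms.intro exI[of _ 1]) simp
    define k where "k x = (u x - u (P x)) / norm w" for x
    have k: "bounded_linear k"
      unfolding k_def
      by (intro bounded_linear_divide[THEN bounded_linear_compose] bounded_linear_sub bu bdd u(1))
    note lk = bounded_linear.linear[OF k]
    define P' where "P' x = P x + k x *\<^sub>R w" for x
    have "linear P'"
      using P(1) lk unfolding P'_def
      by (simp add: linear_iff algebra_simps)
    moreover have "k x = 0" if "x \<in> F" for x using that P(2) by (simp add: k_def)
    moreover have "k v = 1"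
      using False u(3) by (simp add: k_def w_def linear_diff[OF u(1)])
    moreover have "bounded_linear (\<lambda>x. g (P' x))" if "linear g" for g :: "'a \<Rightarrow> real"
      using bounded_linear_add[OF bdd[OF that] bounded_linear_mult_left[THEN
            bounded_linear_compose, OF k, of "g w"]]
      by (simp add: P'_def linear_add[OF that] linear_scale[OF that])
    moreover have "\<forall>x\<in>insert v F. P' x = x"
      using P(2) \<open>k v = 1\<close> \<open>\<And>x. x \<in> F \<Longrightarrow> k x = 0\<close> by (simp add: P'_def w_def)
    ultimately show ?thesis by blast
  qed
qed

theorem bounded_linear_if_finite_dim:
  fixes g :: "'a::real_normed_vector \<Rightarrow> real" and S :: "'a set"
  assumes S: "finite S" "span S = UNIV" and g: "linear g"
  shows "bounded_linear g"
proof -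
  obtain P :: "'a \<Rightarrow> 'a" where P: "linear P" "\<forall>x\<in>S. P x = x" "bounded_linear (\<lambda>x. g (P x))"
    using exists_linear_fixing_finite_set[OF S S(1)] g by blast
  have "P x = id x" for x
    using linear_eq_on_span[OF P(1) linear_id, of S x] P(2) S(2) by auto
  then show ?thesis using P(3) by simp
qed

section \<open>Complex normed spaces\<close>

lemma clinear_iff:
  "clinear f \<longleftrightarrow> (\<forall>x y. f (x + y) = f x + f y) \<and> (\<forall>c x. f (c *\<^sub>C x) = c *\<^sub>C f x)"
  by (auto simp: Vector_Spaces.linear_iff vector_space_scaleC)

lemma clinear_imp_linear: "clinear f \<Longrightarrow> linear f"
  by (simp add: clinear_iff linear_iff scaleR_scaleC)

lemma scaleC_eq_Re_Im: "c *\<^sub>C x = Re c *\<^sub>R x + Im c *\<^sub>R (\<i> *\<^sub>C x)"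
proof -
  have "Re c *\<^sub>R x + Im c *\<^sub>R (\<i> *\<^sub>C x) =
      (complex_of_real (Re c) + complex_of_real (Im c) * \<i>) *\<^sub>C x"
    by (simp only: scaleR_scaleC scaleC_scaleC scaleC_add_left)
  also have "complex_of_real (Re c) + complex_of_real (Im c) * \<i> = c"
    by (simp add: complex_eq_iff)
  finally show ?thesis by (rule sym)
qed

lemma linear_scaleC: "linear (\<lambda>x. c *\<^sub>C x)"
  by (simp add: linear_iff scaleC_add_right scaleR_scaleC scaleC_scaleC mult.commute)

text \<open>A finite complex spanning set together with its multiples by \<open>\<i>\<close> spans over the reals,
  since the real span of this union is closed under \<open>\<i>\<close>.\<close>

lemma finite_dim_complex_imp_real:
  assumes "finite_dim_complex TYPE('b::complex_normed_vector)"
  shows "\<exists>S::'b set. finite S \<and> span S = UNIV"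
proof -
  obtain S where "finite_dimensional_vector_space (scaleC :: complex \<Rightarrow> 'b \<Rightarrow> 'b) S"
    using assms by (auto simp: finite_dim_complex_def)
  then interpret C: finite_dimensional_vector_space "scaleC :: complex \<Rightarrow> 'b \<Rightarrow> 'b" S .
  let ?S = "S \<union> (\<lambda>x. \<i> *\<^sub>C x) ` S"
  have "\<i> *\<^sub>C x \<in> span ?S" if "x \<in> ?S" for x
  proof -
    have "\<i> *\<^sub>C \<i> *\<^sub>C y = - y" for y :: 'b
      using scaleR_scaleC[of "- 1" y] by (simp add: scaleC_scaleC)
    moreover have "- y \<in> span ?S" if "y \<in> S" for y
      using that by (intro span_neg span_base) simp
    ultimately show ?thesis using that by (auto intro: span_base)
  qed
  then have "(\<lambda>x. \<i> *\<^sub>C x) ` span ?S \<subseteq> span ?S"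
    unfolding linear_span_image[OF linear_scaleC, symmetric]
    by (intro span_minimal) auto
  then have "Re c *\<^sub>R x + Im c *\<^sub>R (\<i> *\<^sub>C x) \<in> span ?S" if "x \<in> span ?S" for c x
    using that by (intro span_add span_scale) auto
  then have "C.subspace (span ?S)"
    unfolding C.subspace_def scaleC_eq_Re_Im[symmetric]
    by (auto intro: span_add span_zero)
  then have "C.span S \<subseteq> span ?S"
    by (intro C.span_minimal) (auto intro: span_base)
  then show ?thesis using C.span_Basis C.finite_Basis by (intro exI[of _ ?S]) auto
qed

text \<open>The usual reduction: a complex-linear \<open>\<phi>\<close> is determined by its real part \<open>u\<close> through
  \<open>\<phi> x = u x - \<i> u (\<i> x)\<close>, and rotating \<open>x\<close> until \<open>\<phi> x\<close> is real turns the bound on \<open>u\<close> into one on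
  \<open>\<bar>\<phi>\<bar>\<close>. The continuity of \<open>\<phi>\<close> comes from finite dimension, not from the bound by \<open>p\<close>,
  which may be a different norm.\<close>

theorem complex_hahn_banach_finite_dim:
  fixes p :: "'b::complex_normed_vector \<Rightarrow> real"
  assumes "finite_dim_complex TYPE('b)"
    and add: "\<And>x y. p (x + y) \<le> p x + p y" and scale: "\<And>c x. p (c *\<^sub>C x) = cmod c * p x"
  shows "\<exists>\<phi>\<in>cdual. (\<forall>x. cmod (\<phi> x) \<le> p x) \<and> cmod (\<phi> b) = p b"
proof -
  obtain S :: "'b set" where S: "finite S" "span S = UNIV"
    using finite_dim_complex_imp_real[OF assms(1)] by blast
  have "sublinear p"
    using add by (simp add: sublinear_def scaleR_scaleC scale)
  then obtain u where u: "linear u" "\<And>x. u x \<le> p x" "u b = p b"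
    using hahn_banach_finite_dim[OF S, of p b] by blast
  have u': "linear (\<lambda>x. u (\<i> *\<^sub>C x))"
    using linear_compose[OF linear_scaleC u(1)] by (simp add: o_def)
  define \<phi> where "\<phi> x = complex_of_real (u x) - \<i> * complex_of_real (u (\<i> *\<^sub>C x))" for x
  have Re_\<phi>: "Re (\<phi> x) = u x" for x by (simp add: \<phi>_def)
  have \<phi>_scale: "\<phi> (c *\<^sub>C x) = c * \<phi> x" for c x
  proof -
    have "\<i> *\<^sub>C \<i> *\<^sub>C x = - x"
      using scaleR_scaleC[of "- 1" x] by (simp add: scaleC_scaleC)
    then have "u (\<i> *\<^sub>C c *\<^sub>C x) = Re c * u (\<i> *\<^sub>C x) - Im c * u x"
      unfolding scaleC_eq_Re_Im[of c x] linear_add[OF linear_scaleC] linear_scale[OF linear_scaleC]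
      by (simp add: linear_diff[OF u(1)] linear_scale[OF u(1)])
    moreover have "u (c *\<^sub>C x) = Re c * u x + Im c * u (\<i> *\<^sub>C x)"
      unfolding scaleC_eq_Re_Im[of c x] by (simp add: linear_add[OF u(1)] linear_scale[OF u(1)])
    ultimately show ?thesis by (simp add: \<phi>_def complex_eq_iff algebra_simps)
  qed
  have "clinear \<phi>"
    using \<phi>_scale
    by (simp add: clinear_iff scaleC_complex_def)
      (simp add: \<phi>_def linear_add[OF u(1)] linear_add[OF u'] algebra_simps)
  moreover have "continuous_on UNIV \<phi>"
    unfolding \<phi>_def
    by (intro continuous_intros linear_continuous_on bounded_linear_if_finite_dim[OF S] u(1) u')
  ultimately have "\<phi> \<in> cdual" by (simp add: cdual_def)
  moreover have "cmod (\<phi> x) \<le> p x" for x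
  proof (cases "\<phi> x = 0")
    case True
    have "0 \<le> p x" using sublinear_uminus_ge[OF \<open>sublinear p\<close>, of x]
        scale[of "- 1" x] scaleR_scaleC[of "- 1" x] by simp
    with True show ?thesis by simp
  next
    case False
    define c where "c = cnj (\<phi> x) / cmod (\<phi> x)"
    have "c * \<phi> x = (\<phi> x * cnj (\<phi> x)) / cmod (\<phi> x)" by (simp add: c_def)
    also have "\<dots> = cmod (\<phi> x)"
      using False by (simp only: complex_norm_square[symmetric]) (simp add: power2_eq_square)
    finally have "cmod (\<phi> x) = u (c *\<^sub>C x)"
      using Re_\<phi>[of "c *\<^sub>C x"] \<phi>_scale[of c x] by simp
    also have "\<dots> \<le> p (c *\<^sub>C x)" by (rule u(2))
    also have "\<dots> = p x" using False by (simp add: scale c_def norm_divide)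
    finally show ?thesis .
  qed
  moreover have "p b \<le> cmod (\<phi> b)"
    using Re_\<phi>[of b] complex_Re_le_cmod[of "\<phi> b"] u(3) by simp
  ultimately show ?thesis by (intro bexI[of _ \<phi>]) (auto intro: antisym)
qed

section \<open>The quotient by the kernel\<close>

lemma quotient_space_ker:
  assumes T: "clinear T" "surj T"
  shows "quotient_space (ker T) = range (\<lambda>b. T -` {b})"
proof -
  have "{(x, y). x - y \<in> ker T} `` {x} = T -` {T x}" for x
    by (auto simp: ker_def linear_diff[OF clinear_imp_linear[OF T(1)]])
  then have "quotient_space (ker T) = range (\<lambda>x. T -` {T x})"
    by (auto simp: quotient_space_def quotient_def)
  also have "\<dots> = (\<lambda>b. T -` {b}) ` range T" by auto
  finally show ?thesis by (simp add: T(2))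
qed

lemma induced_map_fibre: "surj T \<Longrightarrow> induced_map T (T -` {b}) = b"
  using surj_image_vimage_eq[of T "{b}"] by (simp only: induced_map_def the_elem_eq)

lemma coset_add_fibre:
  assumes T: "clinear T" "surj T"
  shows "coset_add (T -` {b}) (T -` {c}) = T -` {b + c}"
proof -
  have "z \<in> coset_add (T -` {b}) (T -` {c})" if "T z = b + c" for z
  proof -
    obtain x where x: "T x = b" using T(2) by (metis surjD)
    have "T (z - x) = c"
      using that x linear_diff[OF clinear_imp_linear[OF T(1)]] by simp
    moreover have "z = x + (z - x)" by simp
    ultimately show ?thesis using x unfolding coset_add_def by blast
  qed
  then show ?thesis using T(1) by (auto simp: coset_add_def clinear_iff)
qed

lemma coset_scale_fibre:
  assumes T: "clinear T" "surj T"
  shows "coset_scale (ker T) c (T -` {b}) = T -` {c *\<^sub>C b}"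
proof -
  have "z \<in> coset_scale (ker T) c (T -` {b})" if "T z = c *\<^sub>C b" for z
  proof -
    obtain x where x: "T x = b" using T(2) by (metis surjD)
    have "z - c *\<^sub>C x \<in> ker T"
      using that x T(1) linear_diff[OF clinear_imp_linear[OF T(1)]]
      by (simp add: ker_def clinear_iff)
    moreover have "z = c *\<^sub>C x + (z - c *\<^sub>C x)" by simp
    ultimately show ?thesis using x unfolding coset_scale_def by blast
  qed
  then show ?thesis using T(1) by (auto simp: coset_scale_def ker_def clinear_iff)
qed

lemma induced_map_iso:
  assumes T: "clinear T" "surj T"
  shows "is_linear_iso_on_quotient (ker T) (induced_map T)"
  unfolding is_linear_iso_on_quotient_def quotient_space_ker[OF T]
proof (intro conjI)
  show "bij_betw (induced_map T) (range (\<lambda>b. T -` {b})) UNIV"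
    using induced_map_fibre[OF T(2)] by (intro bij_betwI[where g = "\<lambda>b. T -` {b}"]) auto
qed (use T in \<open>auto simp: coset_add_fibre coset_scale_fibre induced_map_fibre\<close>)

lemma q_norm_eq_quotient_norm: "q_norm T b = quotient_norm (T -` {b})"
  by (simp add: q_norm_def quotient_norm_def image_def vimage_def conj_commute Bex_def)

lemma q_norm_le: "q_norm T (T x) \<le> norm x"
  unfolding q_norm_eq_quotient_norm quotient_norm_def
  by (intro cINF_lower bdd_belowI2[where m = 0]) auto

lemma q_norm_greatest:
  assumes "surj T" "\<And>x. T x = b \<Longrightarrow> m \<le> norm x"
  shows "m \<le> q_norm T b"
proof -
  obtain x where "T x = b" using surjD[OF assms(1), of b] by auto
  then show ?thesis
    unfolding q_norm_eq_quotient_norm quotient_norm_def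
    using assms(2) by (intro cINF_greatest) auto
qed

lemma is_complex_norm_q_norm:
  assumes T: "clinear T" "continuous_on UNIV T" "surj T"
  shows "is_complex_norm (q_norm T)"
proof -
  have T_add: "T (x + y) = T x + T y" and T_scale: "T (c *\<^sub>C x) = c *\<^sub>C T x" for c x y
    using T(1) by (auto simp: clinear_iff)
  have lin: "linear T" by (rule clinear_imp_linear[OF T(1)])
  have nonneg: "q_norm T b \<ge> 0" for b
    by (rule q_norm_greatest[OF T(3)]) simp
  have zero: "q_norm T 0 = 0"
    using q_norm_le[of T 0] nonneg[of 0] by (simp add: linear_0[OF lin])
  have definite: "b = 0" if "q_norm T b = 0" for b
  proof -
    obtain K where K: "K > 0" "\<And>x. norm (T x) \<le> norm x * K"
      using bounded_linear.pos_bounded[OF bounded_linear_if_continuous[OF lin T(2)]] by blast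
    have "norm b / K \<le> q_norm T b"
      using K by (intro q_norm_greatest[OF T(3)]) (auto simp: field_simps)
    then show ?thesis using that K(1) by (simp add: divide_le_0_iff)
  qed
  have triangle: "q_norm T (b + c) \<le> q_norm T b + q_norm T c" for b c
  proof -
    have "q_norm T (b + c) - norm x \<le> norm y" if "T x = b" "T y = c" for x y
      using q_norm_le[of T "x + y"] norm_triangle_ineq[of x y] that by (simp add: T_add)
    then have "q_norm T (b + c) - norm x \<le> q_norm T c" if "T x = b" for x
      using that by (intro q_norm_greatest[OF T(3)]) auto
    then have "q_norm T (b + c) - q_norm T c \<le> q_norm T b"
      by (intro q_norm_greatest[OF T(3)]) (simp add: diff_le_eq add.commute)
    then show ?thesis by simp
  qed
  have scale_le: "q_norm T (c *\<^sub>C b) \<le> cmod c * q_norm T b" if "c \<noteq> 0" for c b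
  proof -
    have "q_norm T (c *\<^sub>C b) / cmod c \<le> q_norm T b"
    proof (rule q_norm_greatest[OF T(3)])
      fix x assume "T x = b"
      then show "q_norm T (c *\<^sub>C b) / cmod c \<le> norm x"
        using q_norm_le[of T "c *\<^sub>C x"] that by (simp add: T_scale norm_scaleC field_simps)
    qed
    then show ?thesis using that by (simp add: field_simps)
  qed
  (* The reverse inequality is scale_le for the inverse scalar. *)
  have "q_norm T (c *\<^sub>C b) = cmod c * q_norm T b" for c b
  proof (cases "c = 0")
    case True
    then show ?thesis using scaleR_scaleC[of 0 b] zero by simp
  next
    case False
    have "inverse c *\<^sub>C c *\<^sub>C b = b"
      using False scaleR_scaleC[of 1 b] by (simp add: scaleC_scaleC)
    then have "q_norm T b \<le> inverse (cmod c) * q_norm T (c *\<^sub>C b)"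
      using scale_le[of "inverse c" "c *\<^sub>C b"] False by (simp add: norm_inverse)
    from mult_left_mono[OF this norm_ge_zero[of c]]
    have "cmod c * q_norm T b \<le> q_norm T (c *\<^sub>C b)"
      using False by (simp flip: mult.assoc)
    then show ?thesis using scale_le[OF False, of b] by simp
  qed
  then show ?thesis
    using nonneg zero definite triangle by (auto simp: is_complex_norm_def)
qed

section \<open>The dual description of the quotient norm\<close>

lemma bounded_linear_dual_map:
  assumes "clinear T" "continuous_on UNIV T" "\<phi> \<in> cdual"
  shows "bounded_linear (dual_map T \<phi>)"
proof -
  have "clinear \<phi>" "continuous_on UNIV \<phi>" using assms(3) by (auto simp: cdual_def)
  then show ?thesis
    unfolding dual_map_def using assms
    by (intro bounded_linear_if_continuous linear_compose clinear_imp_linear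
        continuous_on_compose) (auto intro: continuous_on_subset)
qed

lemma onorm_dual_map_pos:
  assumes "clinear T" "continuous_on UNIV T" "surj T" "\<phi> \<in> cdual" "\<phi> \<noteq> (\<lambda>_. 0)"
  shows "onorm (dual_map T \<phi>) > 0"
proof -
  obtain b x where "\<phi> b \<noteq> 0" "T x = b" using assms(3,5) by (metis surjD)
  then show ?thesis
    unfolding onorm_pos_lt[OF bounded_linear_dual_map[OF assms(1,2,4)]]
    by (auto simp: dual_map_def)
qed

lemma dual_quotient_le_q_norm:
  assumes T: "clinear T" "continuous_on UNIV T" "surj T" and \<phi>: "\<phi> \<in> cdual" "\<phi> \<noteq> (\<lambda>_. 0)"
  shows "cmod (\<phi> b) / onorm (dual_map T \<phi>) \<le> q_norm T b"
proof (rule q_norm_greatest[OF T(3)])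
  fix x assume "T x = b"
  then have "cmod (\<phi> b) \<le> onorm (dual_map T \<phi>) * norm x"
    using onorm[OF bounded_linear_dual_map[OF T(1,2) \<phi>(1)], of x] by (simp add: dual_map_def)
  then show "cmod (\<phi> b) / onorm (dual_map T \<phi>) \<le> norm x"
    using onorm_dual_map_pos[OF T \<phi>] by (simp add: field_simps)
qed

text \<open>The functional that attains \<open>q_norm T b\<close> has pullback norm at most 1, and dividing by a
  positive number at most 1 does not decrease \<open>\<bar>\<phi> b\<bar> = q_norm T b\<close>.\<close>

lemma q_norm_attained:
  fixes T :: "'a::complex_normed_vector \<Rightarrow> 'b::complex_normed_vector"
  assumes fin: "finite_dim_complex TYPE('b)"
    and T: "clinear T" "continuous_on UNIV T" "surj T" and "b \<noteq> 0"
  shows "\<exists>\<phi>\<in>cdual. \<phi> \<noteq> (\<lambda>_. 0) \<and> q_norm T b \<le> cmod (\<phi> b) / onorm (dual_map T \<phi>)"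
proof -
  note q = is_complex_norm_q_norm[OF T, unfolded is_complex_norm_def]
  obtain \<phi> where \<phi>: "\<phi> \<in> cdual" "\<And>y. cmod (\<phi> y) \<le> q_norm T y" "cmod (\<phi> b) = q_norm T b"
    using complex_hahn_banach_finite_dim[of "q_norm T" b, OF fin] q by auto
  have "q_norm T b \<noteq> 0" using q \<open>b \<noteq> 0\<close> by simp
  then have "\<phi> \<noteq> (\<lambda>_. 0)" using \<phi>(3) by auto
  have "cmod (\<phi> (T x)) \<le> 1 * norm x" for x
    using \<phi>(2)[of "T x"] q_norm_le[of T x] by simp
  then have "onorm (dual_map T \<phi>) \<le> 1"
    by (intro onorm_bound) (auto simp: dual_map_def)
  then have "cmod (\<phi> b) / 1 \<le> cmod (\<phi> b) / onorm (dual_map T \<phi>)"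
    using onorm_dual_map_pos[OF T \<phi>(1) \<open>\<phi> \<noteq> (\<lambda>_. 0)\<close>] by (intro divide_left_mono) auto
  then show ?thesis using \<phi> \<open>\<phi> \<noteq> (\<lambda>_. 0)\<close> by auto
qed

theorem theorem29p1:
  fixes T :: "'a::complex_normed_vector \<Rightarrow> 'b::complex_normed_vector"
  assumes "finite_dim_complex TYPE('b)"
    and "clinear T"
    and "continuous_on UNIV T"
    and "surj T"
  shows "is_linear_iso_on_quotient (ker T) (induced_map T)
    \<and> is_complex_norm (q_norm T)
    \<and> (\<forall>C\<in>quotient_space (ker T). q_norm T (induced_map T C) = quotient_norm C)
    \<and> (\<forall>b. ennreal (q_norm T b) =
          (SUP \<phi>\<in>{\<phi> \<in> cdual. \<phi> \<noteq> (\<lambda>_. 0)}.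
             ennreal (cmod (\<phi> b)) / ennreal (onorm (dual_map T \<phi>))))"
proof (intro conjI ballI allI)
  note T = assms(2-4)
  show "is_linear_iso_on_quotient (ker T) (induced_map T)"
    by (rule induced_map_iso[OF assms(2,4)])
  show norm: "is_complex_norm (q_norm T)"
    by (rule is_complex_norm_q_norm[OF T])
  show "q_norm T (induced_map T C) = quotient_norm C" if "C \<in> quotient_space (ker T)" for C
    using that unfolding quotient_space_ker[OF assms(2,4)]
    by (auto simp: induced_map_fibre[OF assms(4)] q_norm_eq_quotient_norm)
  fix b
  let ?\<Phi> = "{\<phi> \<in> cdual. \<phi> \<noteq> (\<lambda>_. 0)}"
  have ratio: "ennreal (cmod (\<phi> b)) / ennreal (onorm (dual_map T \<phi>)) =
      ennreal (cmod (\<phi> b) / onorm (dual_map T \<phi>))" if "\<phi> \<in> ?\<Phi>" for \<phi>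
    using that onorm_dual_map_pos[OF T, of \<phi>] by (simp add: divide_ennreal)
  show "ennreal (q_norm T b) =
      (SUP \<phi>\<in>?\<Phi>. ennreal (cmod (\<phi> b)) / ennreal (onorm (dual_map T \<phi>)))"
  proof (rule antisym)
    show "ennreal (q_norm T b) \<le>
        (SUP \<phi>\<in>?\<Phi>. ennreal (cmod (\<phi> b)) / ennreal (onorm (dual_map T \<phi>)))"
    proof (cases "b = 0")
      (* Separate, since on the zero space there is no nonzero functional to choose. *)
      case True
      then have "q_norm T b = 0" using norm unfolding is_complex_norm_def by blast
      then show ?thesis by simp
    next
      case False
      then obtain \<phi> where "\<phi> \<in> ?\<Phi>" "q_norm T b \<le> cmod (\<phi> b) / onorm (dual_map T \<phi>)"
        using q_norm_attained[OF assms(1) T] by blast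
      then show ?thesis by (intro SUP_upper2[of \<phi>]) (auto simp: ratio ennreal_leI)
    qed
    show "(SUP \<phi>\<in>?\<Phi>. ennreal (cmod (\<phi> b)) / ennreal (onorm (dual_map T \<phi>)))
        \<le> ennreal (q_norm T b)"
      using dual_quotient_le_q_norm[OF T] by (intro SUP_least) (auto simp: ratio ennreal_leI)
  qed
qed

end
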